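(* Let $A,B$ be $n\times n$ complex matrices. Then $\mathbf{s}(A+B)\prec_{\mathrm{w}}\mathbf{s}(A)+\mathbf{s}(B)$.
   Context: For an $n\times n$ complex matrix $A$, $\mathbf{s}(A)=(s_1(A),\ldots,s_n(A))\in\mathbb{R}^n$ is the vector of singular values of $A$ (the nonnegative square roots of the eigenvalues of $A^*A$, with multiplicity), ordered so that $s_1(A)\geq s_2(A)\geq\cdots\geq s_n(A)\geq0$. For $\mathbf{x}\in\mathbb{R}^n$ let $x_{[1]}\geq\cdots\geq x_{[n]}$ denote its entries in decreasing order; $\mathbf{x}\prec_{\mathrm{w}}\mathbf{y}$ (weak majorization) means $\sum_{i=1}^k x_{[i]}\leq\sum_{i=1}^k y_{[i]}$ for each $1\leq k\leq n$. *)

theory Defs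
  imports
    "Jordan_Normal_Form.Schur_Decomposition"
    "HOL-Computational_Algebra.Computational_Algebra"
begin

(* The eigenvalues of A* A, repeated according to their multiplicity as roots of the
   characteristic polynomial. They are nonnegative reals (lemma gram_eigenvalue_real_nonneg
   below), so Re loses nothing in the definition of the singular values. *)
definition gram_eigenvalues :: "complex mat \<Rightarrow> complex multiset" where
  "gram_eigenvalues A = proots (char_poly (mat_adjoint A * A))"

definition singular_values :: "complex mat \<Rightarrow> real vec" where
  "singular_values A =
     vec_of_list (rev (sorted_list_of_multiset (image_mset (\<lambda>z. sqrt (Re z)) (gram_eigenvalues A))))"

(* Indices start at 0: decreasing_rearrangement x $ i is the (i+1)-st largest entry of x. *)
definition decreasing_rearrangement :: "real vec \<Rightarrow> real vec" where
  "decreasing_rearrangement x = vec_of_list (rev (sort (list_of_vec x)))"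

definition weakly_majorized :: "real vec \<Rightarrow> real vec \<Rightarrow> bool" (infix "\<prec>\<^sub>w" 50) where
  "x \<prec>\<^sub>w y \<longleftrightarrow> dim_vec x = dim_vec y \<and>
     (\<forall>k\<in>{1..dim_vec x}.
        (\<Sum>i<k. decreasing_rearrangement x $ i) \<le> (\<Sum>i<k. decreasing_rearrangement y $ i))"

lemma mat_adjoint_carrier:
  assumes "A \<in> carrier_mat m n"
  shows "mat_adjoint A \<in> carrier_mat n m"
  using assms unfolding mat_adjoint_def carrier_mat_def by auto

lemma gram_carrier:
  assumes "A \<in> carrier_mat n n"
  shows "mat_adjoint A * A \<in> carrier_mat n n"
  using mat_adjoint_carrier[OF assms] assms by simp

lemma dim_singular_values:
  assumes "A \<in> carrier_mat n n"
  shows "dim_vec (singular_values A) = n"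
proof -
  have "length (sorted_list_of_multiset M) = size M" for M :: "real multiset"
    by (metis mset_sorted_list_of_multiset size_mset)
  then show ?thesis
    using degree_monic_char_poly[OF gram_carrier[OF assms]]
    by (simp add: singular_values_def gram_eigenvalues_def size_proots_complex
        del: vec_of_list_map)
qed

lemma mat_adjoint_index:
  assumes "A \<in> carrier_mat n n" "i < n" "j < n"
  shows "mat_adjoint A $$ (i, j) = conjugate (A $$ (j, i))"
  using assms unfolding mat_adjoint_def by (simp add: mat_of_rows_index)

lemma gram_eigenvalue_real_nonneg:
  assumes A: "A \<in> carrier_mat n n" and z: "z \<in># gram_eigenvalues A"
  shows "z \<in> \<real> \<and> 0 \<le> Re z"
proof -
  let ?G = "mat_adjoint A * A"
  note G = gram_carrier[OF A]
  have nz: "char_poly ?G \<noteq> 0" using degree_monic_char_poly[OF G] by auto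
  have "poly (char_poly ?G) z = 0" using z nz by (simp add: gram_eigenvalues_def)
  then have "eigenvalue ?G z" using eigenvalue_root_char_poly[OF G] by simp
  then obtain v where v: "v \<in> carrier_vec n" "v \<noteq> 0\<^sub>v n" "?G *\<^sub>v v = z \<cdot>\<^sub>v v"
    using G unfolding eigenvalue_def eigenvector_def by auto
  have Av: "A *\<^sub>v v \<in> carrier_vec n" using A v by simp
  define w where "w = A *\<^sub>v v"
  have w: "w \<in> carrier_vec n" using Av by (simp add: w_def)
  have Gv: "?G *\<^sub>v v = mat_adjoint A *\<^sub>v w"
    unfolding w_def by (rule assoc_mult_mat_vec[OF mat_adjoint_carrier[OF A] A v(1)])
  have "(mat_adjoint A *\<^sub>v w) \<bullet>c v = (\<Sum>i<n. (\<Sum>j<n. cnj (A $$ (j, i)) * w $ j) * cnj (v $ i))"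
    using A v w mat_adjoint_carrier[OF A]
    by (simp add: scalar_prod_def mat_adjoint_index lessThan_atLeast0)
  also have "\<dots> = (\<Sum>i<n. \<Sum>j<n. w $ j * cnj (A $$ (j, i) * v $ i))"
    by (simp add: sum_distrib_right sum_distrib_left mult_ac)
  also have "\<dots> = (\<Sum>j<n. \<Sum>i<n. w $ j * cnj (A $$ (j, i) * v $ i))" by (rule sum.swap)
  also have "\<dots> = (\<Sum>j<n. w $ j * cnj (\<Sum>i<n. A $$ (j, i) * v $ i))"
    by (simp add: sum_distrib_left)
  also have "\<dots> = (\<Sum>j<n. w $ j * cnj (w $ j))"
    using A v by (intro sum.cong) (auto simp: w_def scalar_prod_def lessThan_atLeast0)
  also have "\<dots> = w \<bullet>c w" using w by (simp add: scalar_prod_def lessThan_atLeast0)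
  finally have eq: "z * (v \<bullet>c v) = w \<bullet>c w" using v Gv by (simp)
  have pos: "v \<bullet>c v > 0" using conjugate_square_greater_0_vec[OF v(1)] v(2) by simp
  have nn: "w \<bullet>c w \<ge> 0" by (rule conjugate_square_ge_0_vec)
  obtain r where r: "v \<bullet>c v = of_real r" "r > 0"
    using pos by (metis Re_complex_of_real complex_is_Real_iff less_complex_def of_real_Re zero_complex.sel)
  obtain s where s: "w \<bullet>c w = of_real s" "s \<ge> 0"
    using nn by (metis complex_is_Real_iff less_eq_complex_def of_real_Re zero_complex.sel)
  have "z = of_real (s / r)" using eq r s by (simp add: field_simps)
  then show ?thesis using r s by simp
qed

end

theory Submission
  imports Defs
begin

text \<open>
  The proof rests on Ky Fan's variational principle: for \<open>k \<le> n\<close>, the sum of the \<open>k\<close> largest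
  singular values of \<open>A\<close> is the maximum of \<open>Re (\<Sum>i<k. \<langle>A x\<^sub>i, y\<^sub>i\<rangle>)\<close> over orthonormal families
  \<open>x\<close> and \<open>y\<close> of length \<open>k\<close>. The expression is additive in \<open>A\<close>, so a maximizing pair for \<open>A + B\<close>
  bounds the partial sums for \<open>A + B\<close> by those for \<open>A\<close> plus those for \<open>B\<close>. Since the entries of
  both \<open>s(A + B)\<close> and \<open>s(A) + s(B)\<close> are already in decreasing order, this is weak majorization.

  The principle comes from a singular value decomposition \<open>A v\<^sub>j = s\<^sub>j u\<^sub>j\<close>, where \<open>v\<close> is an
  orthonormal eigenbasis of \<open>A\<^sup>* A\<close> (\<open>hermitian_orthonormal_eigenbasis\<close>). The maximum is attained
  at \<open>x = v\<close>, \<open>y = u\<close> (\<open>ky_fan_attained\<close>). For the upper bound (\<open>ky_fan_upper_bound\<close>), expanding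
  \<open>x\<^sub>i\<close> in the basis \<open>v\<close> gives
  \<open>\<Sum>i<k. \<langle>A x\<^sub>i, y\<^sub>i\<rangle> = \<Sum>j<n. s\<^sub>j (\<Sum>i<k. \<langle>x\<^sub>i, v\<^sub>j\<rangle> \<langle>u\<^sub>j, y\<^sub>i\<rangle>)\<close>.
  By Bessel's inequality, applied once to \<open>x\<close> and \<open>y\<close> and once to \<open>v\<close> and \<open>u\<close>, the real parts of
  the inner sums are bounded by weights \<open>d\<^sub>j \<in> [0, 1]\<close> of total at most \<open>k\<close>, and such a weighted
  sum of a decreasing sequence is at most the sum of its first \<open>k\<close> terms.

  Completing \<open>u\<close> at the zero singular values to an orthonormal basis is unnecessary: Bessel's
  inequality also holds for orthogonal families whose members have norm 0 or 1, so the principle is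
  stated for these \<^emph>\<open>partial\<close> orthonormal families and \<open>u\<^sub>j = 0\<close> is used when \<open>s\<^sub>j = 0\<close>.
\<close>

section \<open>Inner product and matrix action on coordinate functions\<close>

text \<open>
  Vectors of \<open>\<complex>\<^sup>n\<close> are represented by functions on the natural numbers of which only the values
  below \<open>n\<close> matter; linear combinations are then pointwise finite sums. The inner product is linear
  in its first argument.
\<close>

definition cip :: "nat \<Rightarrow> (nat \<Rightarrow> complex) \<Rightarrow> (nat \<Rightarrow> complex) \<Rightarrow> complex" where
  "cip n f g = (\<Sum>r<n. f r * cnj (g r))"

text \<open>The product of an \<open>n \<times> n\<close> matrix with the vector represented by \<open>f\<close>.\<close>

definition mact :: "nat \<Rightarrow> complex mat \<Rightarrow> (nat \<Rightarrow> complex) \<Rightarrow> nat \<Rightarrow> complex" where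
  "mact n A f r = (\<Sum>c<n. A $$ (r, c) * f c)"

lemma cip_cong:
  "(\<And>r. r < n \<Longrightarrow> f r = f' r) \<Longrightarrow> (\<And>r. r < n \<Longrightarrow> g r = g' r) \<Longrightarrow> cip n f g = cip n f' g'"
  by (simp add: cip_def)

lemma cip_commute: "cip n g f = cnj (cip n f g)"
  by (simp add: cip_def mult.commute)

lemma cip_self: "cip n f f = of_real (\<Sum>r<n. (cmod (f r))\<^sup>2)"
  by (simp only: cip_def of_real_sum complex_norm_square)

lemma Re_cip_self_nonneg: "0 \<le> Re (cip n f f)"
  by (simp add: cip_self sum_nonneg)

lemma cip_self_eq_0D: "cip n f f = 0 \<Longrightarrow> r < n \<Longrightarrow> f r = 0"
  unfolding cip_self of_real_eq_0_iff by (subst (asm) sum_nonneg_eq_0_iff) auto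

lemma cip_add_left: "cip n (\<lambda>r. f r + g r) h = cip n f h + cip n g h"
  by (simp add: cip_def algebra_simps sum.distrib)

lemma cip_diff_left: "cip n (\<lambda>r. f r - g r) h = cip n f h - cip n g h"
  by (simp add: cip_def algebra_simps sum_subtractf)

lemma cip_diff_right: "cip n h (\<lambda>r. f r - g r) = cip n h f - cip n h g"
  by (simp add: cip_def algebra_simps sum_subtractf)

lemma cip_scale_left: "cip n (\<lambda>r. c * f r) g = c * cip n f g"
  by (simp add: cip_def sum_distrib_left mult.assoc)

lemma cip_scale_right: "cip n f (\<lambda>r. c * g r) = cnj c * cip n f g"
  by (simp add: cip_def sum_distrib_left mult_ac)

lemma cip_sum_left: "cip n (\<lambda>r. \<Sum>i<k. c i * f i r) g = (\<Sum>i<k. c i * cip n (f i) g)"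
  unfolding cip_def sum_distrib_left sum_distrib_right
  by (subst sum.swap) (simp add: mult_ac)

lemma cip_sum_right: "cip n g (\<lambda>r. \<Sum>i<k. c i * f i r) = (\<Sum>i<k. cnj (c i) * cip n g (f i))"
  by (subst (1 2) cip_commute) (simp add: cip_sum_left)

lemma mact_cong: "(\<And>c. c < n \<Longrightarrow> f c = g c) \<Longrightarrow> mact n A f r = mact n A g r"
  by (simp add: mact_def)

lemma mact_diff: "mact n A (\<lambda>c. f c - g c) r = mact n A f r - mact n A g r"
  by (simp add: mact_def algebra_simps sum_subtractf)

lemma mact_scale: "mact n A (\<lambda>c. a * f c) r = a * mact n A f r"
  by (simp add: mact_def sum_distrib_left mult_ac)

lemma mact_sum: "mact n A (\<lambda>c. \<Sum>i<k. a i * f i c) r = (\<Sum>i<k. a i * mact n A (f i) r)"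
  unfolding mact_def sum_distrib_left by (subst sum.swap) (simp add: mult_ac)

lemma mact_add_mat:
  assumes "A \<in> carrier_mat n n" "B \<in> carrier_mat n n" "r < n"
  shows "mact n (A + B) f r = mact n A f r + mact n B f r"
  using assms by (simp add: mact_def algebra_simps sum.distrib)

lemma mact_mult_mat:
  assumes "A \<in> carrier_mat n n" "B \<in> carrier_mat n n" "r < n"
  shows "mact n (A * B) f r = mact n A (mact n B f) r"
proof -
  have "mact n (A * B) f r = (\<Sum>c<n. \<Sum>k<n. A $$ (r, k) * (B $$ (k, c) * f c))"
    using assms
    by (simp add: mact_def scalar_prod_def lessThan_atLeast0 sum_distrib_left sum_distrib_right mult_ac)
  also have "\<dots> = mact n A (mact n B f) r"
    unfolding mact_def sum_distrib_left by (rule sum.swap)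
  finally show ?thesis .
qed

lemma cip_mact_adjoint:
  assumes "A \<in> carrier_mat n n"
  shows "cip n (mact n (mat_adjoint A) f) g = cip n f (mact n A g)"
proof -
  have "cip n (mact n (mat_adjoint A) f) g = (\<Sum>r<n. \<Sum>c<n. f c * cnj (A $$ (c, r) * g r))"
    using assms by (simp add: cip_def mact_def mat_adjoint_index sum_distrib_left sum_distrib_right mult_ac)
  also have "\<dots> = cip n f (mact n A g)"
    unfolding cip_def mact_def cnj_sum sum_distrib_left by (rule sum.swap)
  finally show ?thesis .
qed

lemma cip_gram:
  assumes "A \<in> carrier_mat n n"
  shows "cip n (mact n (mat_adjoint A * A) f) g = cip n (mact n A f) (mact n A g)"
proof -
  have "cip n (mact n (mat_adjoint A * A) f) g = cip n (mact n (mat_adjoint A) (mact n A f)) g"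
    by (rule cip_cong) (simp_all add: mact_mult_mat[OF mat_adjoint_carrier[OF assms] assms])
  then show ?thesis by (simp add: cip_mact_adjoint[OF assms])
qed

section \<open>Partial orthonormal families\<close>

text \<open>
  The first \<open>k\<close> members of the family are pairwise orthogonal and each of them is either zero or
  of norm 1.
\<close>

definition partial_orthonormal :: "nat \<Rightarrow> nat \<Rightarrow> (nat \<Rightarrow> nat \<Rightarrow> complex) \<Rightarrow> bool" where
  "partial_orthonormal n k y \<longleftrightarrow>
     (\<forall>i<k. \<forall>j<k. i \<noteq> j \<longrightarrow> cip n (y i) (y j) = 0) \<and> (\<forall>i<k. cip n (y i) (y i) \<in> {0, 1})"

text \<open>The first \<open>k\<close> members of the family are orthonormal in \<open>\<complex>\<^sup>n\<close>.\<close>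

definition orthonormal :: "nat \<Rightarrow> nat \<Rightarrow> (nat \<Rightarrow> nat \<Rightarrow> complex) \<Rightarrow> bool" where
  "orthonormal n k y \<longleftrightarrow> (\<forall>i<k. \<forall>j<k. cip n (y i) (y j) = (if i = j then 1 else 0))"

lemma orthonormal_imp_partial: "orthonormal n k y \<Longrightarrow> partial_orthonormal n k y"
  by (simp add: orthonormal_def partial_orthonormal_def)

lemma partial_orthonormal_mono: "partial_orthonormal n k y \<Longrightarrow> l \<le> k \<Longrightarrow> partial_orthonormal n l y"
  by (simp add: partial_orthonormal_def)

lemma partial_orthonormal_norm_le:
  "partial_orthonormal n k y \<Longrightarrow> i < k \<Longrightarrow> Re (cip n (y i) (y i)) \<le> 1"
  by (auto simp: partial_orthonormal_def)

text \<open>Bessel's inequality: \<open>w\<close> minus its projection \<open>p\<close> onto the family has nonnegative square norm.\<close>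

lemma bessel_inequality:
  assumes y: "partial_orthonormal n k y"
  shows "(\<Sum>i<k. (cmod (cip n w (y i)))\<^sup>2) \<le> Re (cip n w w)"
proof -
  define a where "a i = cip n w (y i)" for i
  define p where "p = (\<lambda>r. \<Sum>i<k. a i * y i r)"
  define s where "s = (\<Sum>i<k. (cmod (a i))\<^sup>2)"
  have wp: "cip n w p = of_real s"
    unfolding p_def cip_sum_right s_def a_def[symmetric] of_real_sum
    by (simp only: complex_norm_square mult.commute)
  have pw: "cip n p w = of_real s"
    by (subst cip_commute) (simp add: wp)
  have "cip n p p = (\<Sum>i<k. cnj (a i) * (\<Sum>j<k. a j * cip n (y j) (y i)))"
    by (subst (2) p_def) (simp add: cip_sum_right p_def cip_sum_left)
  also have "\<dots> = (\<Sum>i<k. cnj (a i) * (a i * cip n (y i) (y i)))"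
  proof (intro sum.cong arg_cong2[where f = "(*)"] refl)
    fix i assume "i \<in> {..<k}"
    then have "(\<Sum>j<k. a j * cip n (y j) (y i)) = (\<Sum>j<k. if j = i then a i * cip n (y i) (y i) else 0)"
      using y by (intro sum.cong) (auto simp: partial_orthonormal_def)
    then show "(\<Sum>j<k. a j * cip n (y j) (y i)) = a i * cip n (y i) (y i)"
      using \<open>i \<in> {..<k}\<close> by simp
  qed
  finally have pp: "cip n p p = (\<Sum>i<k. cnj (a i) * (a i * cip n (y i) (y i)))" .
  have "Re (cip n p p) = (\<Sum>i<k. (cmod (a i))\<^sup>2 * Re (cip n (y i) (y i)))"
  proof -
    have "Re (cnj (a i) * (a i * cip n (y i) (y i))) = (cmod (a i))\<^sup>2 * Re (cip n (y i) (y i))" if "i < k" for i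
    proof -
      have "cip n (y i) (y i) = 0 \<or> cip n (y i) (y i) = 1"
        using y that by (auto simp: partial_orthonormal_def)
      then show ?thesis by (auto simp: cmod_power2 simp flip: power2_eq_square)
    qed
    then show ?thesis unfolding pp by simp
  qed
  also have "\<dots> \<le> s"
    unfolding s_def
    by (intro sum_mono mult_left_le) (auto simp: partial_orthonormal_norm_le[OF y])
  finally have "Re (cip n p p) \<le> s" .
  moreover have "0 \<le> Re (cip n (\<lambda>r. w r - p r) (\<lambda>r. w r - p r))"
    by (rule Re_cip_self_nonneg)
  ultimately show ?thesis
    by (simp add: cip_diff_left cip_diff_right wp pw s_def a_def)
qed

text \<open>
  An orthonormal family of length \<open>n\<close> is a basis: for the matrix \<open>V\<close> with columns \<open>v\<^sub>j\<close>,
  \<open>V\<^sup>* V = 1\<close> implies \<open>V V\<^sup>* = 1\<close>.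
\<close>

lemma orthonormal_expansion:
  assumes v: "orthonormal n n v" and r: "r < n"
  shows "x r = (\<Sum>j<n. cip n x (v j) * v j r)"
proof -
  define V where "V = mat n n (\<lambda>(r, j). v j r)"
  define W where "W = mat n n (\<lambda>(j, r). cnj (v j r))"
  have V: "V \<in> carrier_mat n n" and W: "W \<in> carrier_mat n n"
    by (simp_all add: V_def W_def)
  have "W * V = 1\<^sub>m n"
  proof (rule eq_matI)
    fix i j assume "i < dim_row (1\<^sub>m n :: complex mat)" "j < dim_col (1\<^sub>m n :: complex mat)"
    then have "(W * V) $$ (i, j) = cip n (v j) (v i)" "i < n" "j < n"
      by (simp_all add: V_def W_def scalar_prod_def lessThan_atLeast0 cip_def mult.commute)
    then show "(W * V) $$ (i, j) = 1\<^sub>m n $$ (i, j)"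
      using v by (simp add: orthonormal_def)
  qed (simp_all add: V_def W_def)
  then have VW: "V * W = 1\<^sub>m n"
    by (rule mat_mult_left_right_inverse[OF W V])
  have delta: "(\<Sum>j<n. v j r * cnj (v j c)) = (if r = c then 1 else 0)" if "c < n" for c
    using arg_cong[OF VW, of "\<lambda>M. M $$ (r, c)"] r that
    by (simp add: V_def W_def scalar_prod_def lessThan_atLeast0)
  have "(\<Sum>j<n. cip n x (v j) * v j r) = (\<Sum>j<n. \<Sum>c<n. x c * (v j r * cnj (v j c)))"
    by (simp add: cip_def sum_distrib_left sum_distrib_right mult_ac)
  also have "\<dots> = (\<Sum>c<n. x c * (\<Sum>j<n. v j r * cnj (v j c)))"
    unfolding sum_distrib_left by (rule sum.swap)
  also have "\<dots> = (\<Sum>c<n. if r = c then x c else 0)"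
    by (intro sum.cong) (auto simp: delta)
  finally show ?thesis using r by simp
qed

section \<open>Spectral theorem for Hermitian matrices\<close>

text \<open>
  The Schur decomposition provides \<open>G P = P B\<close> with \<open>B\<close> upper triangular, diagonal \<open>es\<close>, and
  \<open>P\<close> invertible but not necessarily unitary. Gram--Schmidt applied to the columns \<open>p\<^sub>j\<close> of \<open>P\<close> turns them into
  eigenvectors: if \<open>w\<close> is the component of \<open>p\<^sub>m\<close> orthogonal to the eigenvectors
  \<open>q\<^sub>0, \<dots>, q\<^bsub>m-1\<^esub>\<close> found so far, then \<open>G w - es\<^sub>m w\<close> lies in their span because \<open>B\<close> is
  triangular, and it is orthogonal to each of them because \<open>G\<close> is Hermitian; hence it vanishes. In
  particular the eigenvalues occur in the order prescribed by \<open>es\<close>.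
\<close>

lemma hermitian_orthonormal_eigenbasis:
  assumes G: "G \<in> carrier_mat n n"
    and herm: "\<And>f g. cip n (mact n G f) g = cip n f (mact n G g)"
    and cp: "char_poly G = (\<Prod>e\<leftarrow>es. [:- e, 1:])"
  obtains v where "orthonormal n n v"
    and "\<And>j r. j < n \<Longrightarrow> r < n \<Longrightarrow> mact n G (v j) r = es ! j * v j r"
proof -
  obtain B P Q where BPQ: "schur_decomposition G es = (B, P, Q)" by (cases "schur_decomposition G es")
  note schur = schur_decomposition[OF G cp BPQ]
  note wit = similar_mat_witD2[OF G conjunct1[OF schur]]
  have ut: "upper_triangular B" and diag: "diag_mat B = es" using schur by auto
  note [simp] = wit(4-7)[THEN carrier_matD(1)] wit(4-7)[THEN carrier_matD(2)]
  have diagB: "B $$ (j, j) = es ! j" if "j < n" for j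
    using that diag by (auto simp: diag_mat_def)
  have GP: "G * P = P * B"
  proof -
    have "G * P = (P * B) * (Q * P)"
      using wit(4-7) unfolding wit(3) by (intro assoc_mult_mat[of _ n n _ n _ n]) auto
    then show ?thesis using wit by simp
  qed
  define p where "p j r = P $$ (r, j)" for j r
  \<comment> \<open>The functionals given by the rows of \<open>Q = P\<^sup>-\<^sup>1\<close> form the dual basis of the columns of \<open>P\<close>;
    they certify that the Gram--Schmidt vectors are nonzero.\<close>
  define \<phi> where "\<phi> l f = (\<Sum>r<n. Q $$ (l, r) * f r)" for l and f :: "nat \<Rightarrow> complex"
  have Gp: "mact n G (p j) r = es ! j * p j r + (\<Sum>i<j. B $$ (i, j) * p i r)"
    if "j < n" "r < n" for j r
  proof -
    have "mact n G (p j) r = (G * P) $$ (r, j)"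
      using that by (simp add: mact_def p_def scalar_prod_def lessThan_atLeast0)
    also have "\<dots> = (\<Sum>i<n. B $$ (i, j) * p i r)"
      unfolding GP using that by (simp add: p_def scalar_prod_def lessThan_atLeast0 mult.commute)
    also have "\<dots> = (\<Sum>i<Suc j. B $$ (i, j) * p i r)"
      using that ut by (intro sum.mono_neutral_right) (auto simp: upper_triangular_def)
    finally show ?thesis using that by (simp add: diagB)
  qed
  have \<phi>p: "\<phi> l (p j) = (if l = j then 1 else 0)" if "l < n" "j < n" for l j
    using arg_cong[OF wit(2), of "\<lambda>M. M $$ (l, j)"] that
    by (simp add: \<phi>_def p_def scalar_prod_def lessThan_atLeast0)
  have \<phi>_comb: "\<phi> l (\<lambda>r. f r - (\<Sum>i<k. a i * g i r)) = \<phi> l f - (\<Sum>i<k. a i * \<phi> l (g i))"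
    for l f a g and k :: nat
  proof -
    have "(\<Sum>r<n. Q $$ (l, r) * (\<Sum>i<k. a i * g i r)) = (\<Sum>i<k. a i * \<phi> l (g i))"
      unfolding \<phi>_def sum_distrib_left by (subst sum.swap) (simp add: mult_ac)
    then show ?thesis by (simp add: \<phi>_def right_diff_distrib sum_subtractf)
  qed
  \<comment> \<open>State after \<open>m\<close> steps: the third clause says that each \<open>q i\<close> lies in the span of
    \<open>p 0, \<dots>, p (m - 1)\<close>, the fourth that these are combinations of the \<open>q j\<close>.\<close>
  define gs where "gs m q c \<longleftrightarrow> orthonormal n m q
      \<and> (\<forall>i<m. \<forall>r<n. mact n G (q i) r = es ! i * q i r)
      \<and> (\<forall>i<m. \<forall>l<n. m \<le> l \<longrightarrow> \<phi> l (q i) = 0)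
      \<and> (\<forall>i<m. \<forall>r<n. p i r = (\<Sum>j<m. c i j * q j r))" for m q c
  have "\<exists>q c. gs m q c" if "m \<le> n" for m
    using that
  proof (induction m)
    case 0
    then show ?case by (simp add: gs_def orthonormal_def)
  next
    case (Suc m)
    then have m: "m < n" by simp
    then obtain q c where "gs m q c" using Suc.IH by auto
    then have q: "orthonormal n m q"
      and Gq: "\<And>i r. i < m \<Longrightarrow> r < n \<Longrightarrow> mact n G (q i) r = es ! i * q i r"
      and \<phi>q: "\<And>i l. i < m \<Longrightarrow> l < n \<Longrightarrow> m \<le> l \<Longrightarrow> \<phi> l (q i) = 0"
      and pq: "\<And>i r. i < m \<Longrightarrow> r < n \<Longrightarrow> p i r = (\<Sum>j<m. c i j * q j r)"
      by (simp_all add: gs_def)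
    define a where "a i = cip n (p m) (q i)" for i
    define w where "w r = p m r - (\<Sum>i<m. a i * q i r)" for r
    have qq: "(\<Sum>i<m. b i * cip n (q i) (q j)) = b j" if "j < m" for b j
    proof -
      have "(\<Sum>i<m. b i * cip n (q i) (q j)) = (\<Sum>i<m. if i = j then b j else 0)"
        using q that by (intro sum.cong) (auto simp: orthonormal_def)
      then show ?thesis using that by simp
    qed
    have wq: "cip n w (q j) = 0" if "j < m" for j
      unfolding w_def cip_diff_left cip_sum_left qq[OF that] by (simp add: a_def)
    have qw: "cip n (q j) w = 0" if "j < m" for j
      by (subst cip_commute) (simp add: wq that)
    have \<phi>w: "\<phi> l w = (if l = m then 1 else 0)" if "l < n" "m \<le> l" for l
      using that m unfolding w_def[abs_def] \<phi>_comb by (simp add: \<phi>p \<phi>q)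
    have "cip n w w \<noteq> 0"
    proof
      assume "cip n w w = 0"
      then have "\<phi> m w = 0" by (simp add: \<phi>_def cip_self_eq_0D)
      then show False using \<phi>w m by simp
    qed
    define N :: complex where "N = of_real (sqrt (Re (cip n w w)))"
    have NN: "N * cnj N = cip n w w"
      using Re_cip_self_nonneg[of n w] by (simp add: N_def cip_self flip: of_real_mult)
    with \<open>cip n w w \<noteq> 0\<close> have N0: "N \<noteq> 0" by auto
    define d where "d j = (\<Sum>i<m. B $$ (i, m) * c i j) + es ! m * a j - a j * es ! j" for j
    have Gw: "mact n G w r = es ! m * w r + (\<Sum>j<m. d j * q j r)" if r: "r < n" for r
    proof -
      have "(\<Sum>i<m. B $$ (i, m) * p i r) = (\<Sum>i<m. \<Sum>j<m. B $$ (i, m) * c i j * q j r)"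
        using r by (simp add: pq sum_distrib_left mult.assoc)
      also have "\<dots> = (\<Sum>j<m. (\<Sum>i<m. B $$ (i, m) * c i j) * q j r)"
        unfolding sum_distrib_right by (rule sum.swap)
      finally have "mact n G (p m) r = es ! m * p m r + (\<Sum>j<m. (\<Sum>i<m. B $$ (i, m) * c i j) * q j r)"
        using Gp[OF m r] by simp
      moreover have "mact n G w r = mact n G (p m) r - (\<Sum>j<m. a j * (es ! j * q j r))"
        unfolding w_def mact_diff mact_sum using r by (simp add: Gq)
      ultimately show ?thesis
        by (simp add: w_def d_def algebra_simps sum.distrib sum_subtractf sum_distrib_left)
    qed
    have d0: "d j = 0" if j: "j < m" for j
    proof -
      have "cip n (mact n G w) (q j) = cip n w (mact n G (q j))" by (rule herm)
      also have "\<dots> = cip n w (\<lambda>r. es ! j * q j r)"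
        using j by (intro cip_cong) (simp_all add: Gq)
      also have "\<dots> = 0" using j by (simp add: cip_scale_right wq)
      finally have "0 = cip n (\<lambda>r. es ! m * w r + (\<Sum>j<m. d j * q j r)) (q j)"
        by (subst cip_cong[where f' = "mact n G w"]) (auto simp: Gw)
      then show ?thesis using j by (simp add: cip_add_left cip_scale_left cip_sum_left qq wq)
    qed
    define q' where "q' i = (if i < m then q i else (\<lambda>r. inverse N * w r))" for i
    define c' where "c' i j = (if i < m then (if j < m then c i j else 0) else if j < m then a j else N)"
      for i j
    have "orthonormal n (Suc m) q'"
      unfolding orthonormal_def
    proof (intro allI impI)
      fix i j assume ij: "i < Suc m" "j < Suc m"
      have "inverse N * (inverse (cnj N) * cip n w w) = 1"
        using N0 by (simp add: field_simps flip: NN)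
      then show "cip n (q' i) (q' j) = (if i = j then 1 else 0)"
        using ij q N0
        by (auto simp: q'_def cip_scale_left cip_scale_right wq qw orthonormal_def less_Suc_eq)
    qed
    moreover have "\<forall>i<Suc m. \<forall>r<n. mact n G (q' i) r = es ! i * q' i r"
      by (auto simp: q'_def Gq mact_scale Gw d0 less_Suc_eq)
    moreover have "\<forall>i<Suc m. \<forall>l<n. Suc m \<le> l \<longrightarrow> \<phi> l (q' i) = 0"
    proof (intro allI impI)
      fix i l assume il: "i < Suc m" "l < n" "Suc m \<le> l"
      have "\<phi> l (\<lambda>r. inverse N * w r) = inverse N * \<phi> l w"
        by (simp add: \<phi>_def sum_distrib_left mult_ac)
      then show "\<phi> l (q' i) = 0" using il by (simp add: q'_def \<phi>q \<phi>w)
    qed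
    moreover have "\<forall>i<Suc m. \<forall>r<n. p i r = (\<Sum>j<Suc m. c' i j * q' j r)"
    proof (intro allI impI)
      fix i r assume ir: "i < Suc m" "r < n"
      then consider "i < m" | "i = m" by linarith
      then show "p i r = (\<Sum>j<Suc m. c' i j * q' j r)"
      proof cases
        case 1 then show ?thesis using ir by (simp add: c'_def q'_def pq)
      next
        case 2 then show ?thesis using N0 by (simp add: c'_def q'_def w_def field_simps)
      qed
    qed
    ultimately show ?case unfolding gs_def by blast
  qed
  from this[of n] obtain q where "orthonormal n n q"
    "\<forall>i<n. \<forall>r<n. mact n G (q i) r = es ! i * q i r"
    by (auto simp: gs_def)
  then show thesis using that by blast
qed

section \<open>Singular value decomposition\<close>

lemma singular_values_nonneg:
  assumes A: "A \<in> carrier_mat n n" and i: "i < n"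
  shows "0 \<le> singular_values A $ i"
proof -
  have "singular_values A $ i \<in> set (list_of_vec (singular_values A))"
    using dim_singular_values[OF A] i by (metis nth_mem length_list_of_vec list_of_vec_index)
  then have "\<exists>z \<in># gram_eigenvalues A. singular_values A $ i = sqrt (Re z)"
    by (auto simp: singular_values_def list_vec simp del: vec_of_list_map)
  then show ?thesis using gram_eigenvalue_real_nonneg[OF A] by auto
qed

lemma singular_values_decreasing:
  assumes A: "A \<in> carrier_mat n n" and ij: "i \<le> j" "j < n"
  shows "singular_values A $ j \<le> singular_values A $ i"
proof -
  define xs where "xs = sorted_list_of_multiset (image_mset (\<lambda>z. sqrt (Re z)) (gram_eigenvalues A))"
  have s: "singular_values A = vec_of_list (rev xs)"
    by (simp add: singular_values_def xs_def)
  have len: "length xs = n"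
    using dim_singular_values[OF A] by (simp add: s)
  have "sorted xs" by (simp add: xs_def sorted_sorted_list_of_multiset)
  then show ?thesis
    using ij len by (simp add: s vec_of_list_index rev_nth sorted_nth_mono)
qed

text \<open>
  The eigenvalues of \<open>A\<^sup>* A\<close> are listed here in the order of the singular values, so that the
  resulting eigenbasis is indexed accordingly.
\<close>

lemma char_poly_gram:
  assumes A: "A \<in> carrier_mat n n"
  shows "char_poly (mat_adjoint A * A) =
    (\<Prod>e\<leftarrow>map (\<lambda>s. complex_of_real (s\<^sup>2)) (list_of_vec (singular_values A)). [:- e, 1:])"
proof -
  let ?G = "mat_adjoint A * A" and ?es = "map (\<lambda>s. complex_of_real (s\<^sup>2)) (list_of_vec (singular_values A))"
  have "mset ?es = image_mset (\<lambda>z. complex_of_real ((sqrt (Re z))\<^sup>2)) (gram_eigenvalues A)"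
    by (simp add: singular_values_def list_vec image_mset.compositionality o_def del: vec_of_list_map)
  also have "\<dots> = image_mset (\<lambda>z. z) (gram_eigenvalues A)"
    using gram_eigenvalue_real_nonneg[OF A]
    by (intro image_mset_cong) (simp add: complex_is_Real_iff complex_eq_iff)
  finally have es: "mset ?es = proots (char_poly ?G)" by (simp add: gram_eigenvalues_def)
  have "(\<Prod>e\<leftarrow>?es. [:- e, 1:]) = (\<Prod>e\<in>#proots (char_poly ?G). [:- e, 1:])"
    unfolding es[symmetric] by (simp add: prod_mset_prod_list flip: mset_map)
  also have "\<dots> = char_poly ?G"
    using complex_poly_decompose_multiset[of "char_poly ?G"] degree_monic_char_poly[OF gram_carrier[OF A]]
    by simp
  finally show ?thesis by simp
qed

lemma singular_value_decomposition:
  assumes A: "A \<in> carrier_mat n n"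
  obtains v u where "orthonormal n n v" "partial_orthonormal n n u"
    and "\<And>j r. j < n \<Longrightarrow> r < n \<Longrightarrow> mact n A (v j) r = of_real (singular_values A $ j) * u j r"
    and "\<And>j. j < n \<Longrightarrow> singular_values A $ j \<noteq> 0 \<Longrightarrow> cip n (u j) (u j) = 1"
proof -
  let ?s = "\<lambda>j. singular_values A $ j"
  have "cip n (mact n (mat_adjoint A * A) f) g = cip n f (mact n (mat_adjoint A * A) g)" for f g
    unfolding cip_gram[OF A]
    by (subst (1 2) cip_commute) (simp add: cip_gram[OF A])
  then obtain v where v: "orthonormal n n v"
    and Gv: "\<And>j r. j < n \<Longrightarrow> r < n \<Longrightarrow> mact n (mat_adjoint A * A) (v j) r
      = map (\<lambda>s. complex_of_real (s\<^sup>2)) (list_of_vec (singular_values A)) ! j * v j r"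
    using hermitian_orthonormal_eigenbasis[OF gram_carrier[OF A] _ char_poly_gram[OF A]] by blast
  have AvAv: "cip n (mact n A (v i)) (mact n A (v j)) = (if i = j then of_real ((?s i)\<^sup>2) else 0)"
    if "i < n" "j < n" for i j
  proof -
    have "cip n (mact n A (v i)) (mact n A (v j)) = cip n (\<lambda>r. of_real ((?s i)\<^sup>2) * v i r) (v j)"
      unfolding cip_gram[OF A, symmetric] using that dim_singular_values[OF A]
      by (intro cip_cong) (simp_all add: Gv list_of_vec_index)
    then show ?thesis using v that by (simp add: cip_scale_left orthonormal_def)
  qed
  \<comment> \<open>The inverse of zero is zero, so \<open>u j = 0\<close> whenever the singular value vanishes.\<close>
  define u where "u j = (\<lambda>r. inverse (of_real (?s j)) * mact n A (v j) r)" for j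
  have uu: "cip n (u i) (u j) = (if i = j \<and> ?s i \<noteq> 0 then 1 else 0)" if "i < n" "j < n" for i j
    unfolding u_def cip_scale_left cip_scale_right AvAv[OF that]
    by (simp add: power2_eq_square field_simps)
  show thesis
  proof (rule that[OF v])
    show "partial_orthonormal n n u" by (simp add: partial_orthonormal_def uu)
    show "mact n A (v j) r = of_real (?s j) * u j r" if "j < n" "r < n" for j r
    proof (cases "?s j = 0")
      case True
      then have "cip n (mact n A (v j)) (mact n A (v j)) = 0" using AvAv that by simp
      then show ?thesis using True that cip_self_eq_0D[of n "mact n A (v j)"] by simp
    next
      case False
      then show ?thesis by (simp add: u_def)
    qed
  qed (simp add: uu)
qed

section \<open>Ky Fan's variational principle\<close>

lemma weighted_sum_le_initial_sum:
  fixes s d :: "nat \<Rightarrow> real"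
  assumes k: "k \<le> n" and dec: "\<And>i j. i \<le> j \<Longrightarrow> j < n \<Longrightarrow> s j \<le> s i"
    and nonneg: "\<And>i. i < n \<Longrightarrow> 0 \<le> s i"
    and d: "\<And>j. j < n \<Longrightarrow> 0 \<le> d j" "\<And>j. j < n \<Longrightarrow> d j \<le> 1" and sum: "(\<Sum>j<n. d j) \<le> real k"
  shows "(\<Sum>j<n. s j * d j) \<le> (\<Sum>j<k. s j)"
proof (cases "k = 0")
  case True
  then have "(\<Sum>j<n. d j) = 0"
    using sum d(1) by (intro antisym sum_nonneg) auto
  then have "\<forall>j<n. d j = 0"
    using d(1) by (subst (asm) sum_nonneg_eq_0_iff) auto
  then show ?thesis by (simp add: True)
next
  case False
  \<comment> \<open>After subtracting the last of the \<open>k\<close> leading terms, the remaining coefficients are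
    nonnegative below \<open>k\<close> and nonpositive from \<open>k\<close> on.\<close>
  define t where "t = s (k - 1)"
  have t: "0 \<le> t" using nonneg k False by (simp add: t_def)
  have "(\<Sum>j<n. s j * d j) = (\<Sum>j<n. (s j - t) * d j) + t * (\<Sum>j<n. d j)"
    by (simp add: sum_distrib_left algebra_simps sum_subtractf)
  also have "\<dots> \<le> (\<Sum>j<n. if j < k then s j - t else 0) + t * real k"
  proof (intro add_mono sum_mono mult_left_mono sum t)
    fix j assume "j \<in> {..<n}"
    then have j: "j < n" by simp
    show "(s j - t) * d j \<le> (if j < k then s j - t else 0)"
    proof (cases "j < k")
      case True
      then have "t \<le> s j" using dec[of j "k - 1"] k by (simp add: t_def)
      then show ?thesis using True d(2)[OF j] by (simp add: mult_left_le)
    next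
      case False
      then have "s j \<le> t" using dec[of "k - 1" j] j by (simp add: t_def)
      then show ?thesis using False d(1)[OF j] by (simp add: mult_nonpos_nonneg)
    qed
  qed
  also have "(\<Sum>j<n. if j < k then s j - t else 0) = (\<Sum>j<k. s j - t)"
    using k by (intro sum.mono_neutral_cong_right) auto
  finally show ?thesis by (simp add: sum_subtractf)
qed

lemma ky_fan_upper_bound:
  assumes A: "A \<in> carrier_mat n n" and k: "k \<le> n"
    and x: "partial_orthonormal n k x" and y: "partial_orthonormal n k y"
  shows "Re (\<Sum>i<k. cip n (mact n A (x i)) (y i)) \<le> (\<Sum>i<k. singular_values A $ i)"
proof -
  let ?s = "\<lambda>j. singular_values A $ j"
  obtain v u where v: "orthonormal n n v" and u: "partial_orthonormal n n u"
    and Av: "\<And>j r. j < n \<Longrightarrow> r < n \<Longrightarrow> mact n A (v j) r = of_real (?s j) * u j r"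
    by (rule singular_value_decomposition[OF A]) (rule that)
  define a where "a i j = cip n (x i) (v j)" for i j
  define b where "b i j = cip n (u j) (y i)" for i j
  \<comment> \<open>Bounds \<open>\<Sum>i<k. Re (a i j * b i j)\<close> by the inequality of arithmetic and geometric means.\<close>
  define d where "d j = (\<Sum>i<k. ((cmod (a i j))\<^sup>2 + (cmod (b i j))\<^sup>2) / 2)" for j
  have Ax: "mact n A (x i) r = (\<Sum>j<n. a i j * of_real (?s j) * u j r)" if "r < n" for i r
  proof -
    have "mact n A (x i) r = mact n A (\<lambda>r. \<Sum>j<n. a i j * v j r) r"
      unfolding a_def by (rule mact_cong) (rule orthonormal_expansion[OF v])
    then show ?thesis using that by (simp add: mact_sum Av mult.assoc)
  qed
  have "(\<Sum>i<k. cip n (mact n A (x i)) (y i)) = (\<Sum>i<k. \<Sum>j<n. of_real (?s j) * (a i j * b i j))"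
  proof (intro sum.cong refl)
    fix i
    have "cip n (mact n A (x i)) (y i) = cip n (\<lambda>r. \<Sum>j<n. a i j * of_real (?s j) * u j r) (y i)"
      by (rule cip_cong) (simp_all add: Ax)
    then show "cip n (mact n A (x i)) (y i) = (\<Sum>j<n. of_real (?s j) * (a i j * b i j))"
      unfolding cip_sum_left b_def by (simp add: mult_ac)
  qed
  also have "\<dots> = (\<Sum>j<n. of_real (?s j) * (\<Sum>i<k. a i j * b i j))"
    unfolding sum_distrib_left by (rule sum.swap)
  finally have "Re (\<Sum>i<k. cip n (mact n A (x i)) (y i)) = (\<Sum>j<n. ?s j * (\<Sum>i<k. Re (a i j * b i j)))"
    by simp
  also have "\<dots> \<le> (\<Sum>j<n. ?s j * d j)"
  proof (intro sum_mono mult_left_mono)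
    fix j assume "j \<in> {..<n}"
    then show "0 \<le> ?s j" using singular_values_nonneg[OF A] by simp
    have "Re (a i j * b i j) \<le> ((cmod (a i j))\<^sup>2 + (cmod (b i j))\<^sup>2) / 2" for i
    proof -
      have "Re (a i j * b i j) \<le> cmod (a i j) * cmod (b i j)"
        by (metis complex_Re_le_cmod norm_mult)
      then show ?thesis using sum_squares_bound[of "cmod (a i j)" "cmod (b i j)"] by simp
    qed
    then show "(\<Sum>i<k. Re (a i j * b i j)) \<le> d j" unfolding d_def by (rule sum_mono)
  qed
  also have "\<dots> \<le> (\<Sum>j<k. ?s j)"
  proof (rule weighted_sum_le_initial_sum[OF k])
    have swap: "cmod (cip n f g) = cmod (cip n g f)" for f g
      by (subst cip_commute) simp
    show "0 \<le> d j" for j unfolding d_def by (intro sum_nonneg) simp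
    show "d j \<le> 1" if j: "j < n" for j
    proof -
      have "(\<Sum>i<k. (cmod (a i j))\<^sup>2) \<le> Re (cip n (v j) (v j))"
        unfolding a_def swap[of _ "v j"] by (rule bessel_inequality[OF x])
      moreover have "(\<Sum>i<k. (cmod (b i j))\<^sup>2) \<le> Re (cip n (u j) (u j))"
        unfolding b_def by (rule bessel_inequality[OF y])
      ultimately show ?thesis
        using partial_orthonormal_norm_le[OF u j]
          partial_orthonormal_norm_le[OF orthonormal_imp_partial[OF v] j]
        by (simp add: d_def sum.distrib flip: sum_divide_distrib)
    qed
    have "(\<Sum>j<n. d j) = (\<Sum>i<k. ((\<Sum>j<n. (cmod (a i j))\<^sup>2) + (\<Sum>j<n. (cmod (b i j))\<^sup>2)) / 2)"
      unfolding d_def by (subst sum.swap) (simp add: sum.distrib flip: sum_divide_distrib)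
    also have "\<dots> \<le> (\<Sum>i<k. 1)"
    proof (rule sum_mono)
      fix i assume "i \<in> {..<k}"
      then have i: "i < k" by simp
      have "(\<Sum>j<n. (cmod (a i j))\<^sup>2) \<le> Re (cip n (x i) (x i))"
        unfolding a_def by (rule bessel_inequality[OF orthonormal_imp_partial[OF v]])
      moreover have "(\<Sum>j<n. (cmod (b i j))\<^sup>2) \<le> Re (cip n (y i) (y i))"
        unfolding b_def swap[of _ "y i"] by (rule bessel_inequality[OF u])
      ultimately show "((\<Sum>j<n. (cmod (a i j))\<^sup>2) + (\<Sum>j<n. (cmod (b i j))\<^sup>2)) / 2 \<le> 1"
        using partial_orthonormal_norm_le[OF x i] partial_orthonormal_norm_le[OF y i] by simp
    qed
    finally show "(\<Sum>j<n. d j) \<le> real k" by simp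
  qed (use singular_values_decreasing[OF A] singular_values_nonneg[OF A] in auto)
  finally show ?thesis .
qed

lemma ky_fan_attained:
  assumes A: "A \<in> carrier_mat n n" and k: "k \<le> n"
  obtains x y where "partial_orthonormal n k x" "partial_orthonormal n k y"
    and "Re (\<Sum>i<k. cip n (mact n A (x i)) (y i)) = (\<Sum>i<k. singular_values A $ i)"
proof -
  let ?s = "\<lambda>j. singular_values A $ j"
  obtain v u where v: "orthonormal n n v" and u: "partial_orthonormal n n u"
    and Av: "\<And>j r. j < n \<Longrightarrow> r < n \<Longrightarrow> mact n A (v j) r = of_real (?s j) * u j r"
    and uu: "\<And>j. j < n \<Longrightarrow> ?s j \<noteq> 0 \<Longrightarrow> cip n (u j) (u j) = 1"
    using singular_value_decomposition[OF A] by blast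
  have "cip n (mact n A (v i)) (u i) = of_real (?s i)" if "i < n" for i
  proof -
    have "cip n (mact n A (v i)) (u i) = cip n (\<lambda>r. of_real (?s i) * u i r) (u i)"
      by (rule cip_cong) (simp_all add: Av that)
    then show ?thesis using uu[OF that] by (cases "?s i = 0") (simp_all add: cip_scale_left cip_def)
  qed
  then have "Re (\<Sum>i<k. cip n (mact n A (v i)) (u i)) = (\<Sum>i<k. ?s i)"
    using k by simp
  then show thesis
    using that partial_orthonormal_mono[OF _ k] orthonormal_imp_partial[OF v] u by blast
qed

lemma singular_value_sum_subadditive:
  assumes A: "A \<in> carrier_mat n n" and B: "B \<in> carrier_mat n n" and k: "k \<le> n"
  shows "(\<Sum>i<k. singular_values (A + B) $ i)
    \<le> (\<Sum>i<k. singular_values A $ i) + (\<Sum>i<k. singular_values B $ i)"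
proof -
  have "A + B \<in> carrier_mat n n" using A B by simp
  then obtain x y where x: "partial_orthonormal n k x" and y: "partial_orthonormal n k y"
    and "Re (\<Sum>i<k. cip n (mact n (A + B) (x i)) (y i)) = (\<Sum>i<k. singular_values (A + B) $ i)"
    using ky_fan_attained k by blast
  moreover have "cip n (mact n (A + B) f) g = cip n (mact n A f) g + cip n (mact n B f) g" for f g
    unfolding cip_add_left[symmetric] by (rule cip_cong) (simp_all add: mact_add_mat[OF A B])
  ultimately have "(\<Sum>i<k. singular_values (A + B) $ i) =
      Re (\<Sum>i<k. cip n (mact n A (x i)) (y i)) + Re (\<Sum>i<k. cip n (mact n B (x i)) (y i))"
    by (simp add: sum.distrib)
  then show ?thesis
    using ky_fan_upper_bound[OF A k x y] ky_fan_upper_bound[OF B k x y] by linarith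
qed

section \<open>Weak majorization\<close>

lemma decreasing_rearrangement_id:
  assumes "\<And>i j. i \<le> j \<Longrightarrow> j < dim_vec x \<Longrightarrow> x $ j \<le> x $ i"
  shows "decreasing_rearrangement x = x"
proof -
  have "sorted (rev (list_of_vec x))"
    using assms by (simp add: sorted_rev_iff_nth_mono list_of_vec_index)
  then have "sort (list_of_vec x) = rev (list_of_vec x)"
    by (intro properties_for_sort) simp_all
  then show ?thesis by (simp add: decreasing_rearrangement_def vec_list)
qed

theorem theorem12p1:
  fixes A B :: "complex mat" and n :: nat
  assumes "A \<in> carrier_mat n n" and "B \<in> carrier_mat n n"
  shows "singular_values (A + B) \<prec>\<^sub>w singular_values A + singular_values B"
proof -
  note A = assms(1) and B = assms(2)
  have AB: "A + B \<in> carrier_mat n n" using A B by simp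
  note [simp] = dim_singular_values[OF A] dim_singular_values[OF B] dim_singular_values[OF AB]
  have "decreasing_rearrangement (singular_values (A + B)) = singular_values (A + B)"
    by (rule decreasing_rearrangement_id) (simp add: singular_values_decreasing[OF AB])
  moreover have "decreasing_rearrangement (singular_values A + singular_values B)
      = singular_values A + singular_values B"
    by (rule decreasing_rearrangement_id)
      (simp add: add_mono singular_values_decreasing[OF A] singular_values_decreasing[OF B])
  ultimately show ?thesis
    using singular_value_sum_subadditive[OF A B]
    by (simp add: weakly_majorized_def sum.distrib)
qed

end
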